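(* Let $c\in\{-1,1\}$, let $n\geq 1$ be an integer, and let $\alpha\colon I\subset\mathbb{R}\to\mathbb{M}^{n+1}(c)$ be a $C^2$ curve parametrized by arc length, with a rotation minimizing frame $\{T,N_1,\ldots,N_n\}$ along $\alpha$ and associated curvatures $\kappa_1,\ldots,\kappa_n$. If $\alpha$ is contained in a totally umbilical hypersurface $U_{\vec a,\sigma}$ of $\mathbb{M}^{n+1}(c)$, then there is a linear relation $$\sum_{i=1}^n a_i\kappa_i(s)+\sigma=0\quad\text{for all } s\in I,$$ where $a_i\in\mathbb{R}$, $1\leq i\leq n$, are real constants. Conversely, if such a relation $\sum_{i=1}^n a_i\kappa_i(s)+\sigma=0$ holds for all $s\in I$, with real constants $a_1,\ldots,a_n$ and $\sigma$, then $\alpha$ is contained in a totally umbilical hypersurface of $\mathbb{M}^{n+1}(c)$.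
   Context: Model: endow $\mathbb{R}^{n+2}$ with the metric $\langle\cdot,\cdot\rangle=dx_1^2+\cdots+dx_{n+1}^2+c\,dx_{n+2}^2$. The space form $\mathbb{M}^{n+1}(c)$ of constant sectional curvature $c$ is $\{p\in\mathbb{R}^{n+2}:\langle p,p\rangle=c\}$ (for $c=-1$, only the component with $x_{n+2}>0$) with the induced Riemannian metric and Levi-Civita connection $\nabla$; so it is $\mathbb{H}^{n+1}$ for $c=-1$ and the unit sphere $\mathbb{S}^{n+1}$ for $c=1$. Totally umbilical hypersurfaces: these are the (nonempty) sets $U_{\vec a,\sigma}=\{p\in\mathbb{M}^{n+1}(c):\langle p,\vec a\rangle=\sigma\}$ with $\vec a\in\mathbb{R}^{n+2}$, $\vec a\neq0$, $\langle\vec a,\vec a\rangle=\epsilon\in\{-1,0,1\}$, $\sigma\in\mathbb{R}$, where: if $c=1$, then $\epsilon=1$ and $\sigma\in(-1,1)$; if $c=-1$, then either $\epsilon=1$ and $\sigma$ is arbitrary, or $\epsilon=0$ and $\sigma\neq0$, or $\epsilon=-1$ and $|\sigma|>1$. Rotation minimizing (RM) frame along $\alpha$: an orthonormal frame $\{T,N_1,\ldots,N_n\}$ of $\mathbb{M}^{n+1}(c)$ along $\alpha$ with $T=\alpha'$ such that $\nabla_TN_i$ is parallel (proportional) to $T$ for every $i$. The associated curvatures $\kappa_i$ are the functions defined by $\nabla_TT=\sum_{i=1}^n\kappa_iN_i$ and $\nabla_TN_i=-\kappa_iT$, $1\leq i\leq n$. "$\alpha$ is contained in $S$" means $\alpha(I)\subset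 S$.
   Formalization: The linear relation is required to be nontrivial (a_1,...,a_n and σ not all zero) in both directions; with all of them zero the relation holds for every curve, so the converse as written would be false, e.g. for a curve on the unit 2-sphere that lies in no circle. *)

theory Defs
  imports "HOL-Analysis.Analysis"
begin

(* R^(n+2) is modelled as (real ^ 'm) * real with CARD('m) = n + 1; the second
   component is the coordinate x_(n+2). *)
type_synonym 'm ambient = "(real ^ 'm) \<times> real"

definition ambient_metric :: "real \<Rightarrow> 'm::finite ambient \<Rightarrow> 'm ambient \<Rightarrow> real" where
  "ambient_metric c p q = (\<Sum>i\<in>UNIV. fst p $ i * fst q $ i) + c * (snd p * snd q)"

lemma ambient_metric_diff_left: "ambient_metric c (u - v) w = ambient_metric c u w - ambient_metric c v w"
  by (simp add: ambient_metric_def left_diff_distrib right_diff_distrib sum_subtractf)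

lemma ambient_metric_scaleR_left: "ambient_metric c (r *\<^sub>R v) w = r * ambient_metric c v w"
  by (simp add: ambient_metric_def distrib_left sum_distrib_left mult_ac)

lemma ambient_metric_commute: "ambient_metric c v w = ambient_metric c w v"
  by (simp add: ambient_metric_def mult_ac)

definition space_form :: "real \<Rightarrow> 'm::finite ambient set" where
  "space_form c = {p. ambient_metric c p p = c \<and> (c = -1 \<longrightarrow> snd p > 0)}"

(* Kernel at p of the differential of the defining function q |-> ambient_metric c q q - c. *)
definition tangent_space :: "real \<Rightarrow> 'm::finite ambient \<Rightarrow> 'm ambient set" where
  "tangent_space c p = {v. ambient_metric c v p = 0}"

(* Projection onto tangent_space c p, orthogonal with respect to ambient_metric c; the two
   lemmas that follow characterize it. *)
definition tangential :: "real \<Rightarrow> 'm::finite ambient \<Rightarrow> 'm ambient \<Rightarrow> 'm ambient" where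
  "tangential c p v = v - (ambient_metric c v p / ambient_metric c p p) *\<^sub>R p"

lemma tangential_in_tangent_space:
  assumes "ambient_metric c p p \<noteq> 0"
  shows "tangential c p v \<in> tangent_space c p"
  using assms
  by (simp add: tangent_space_def tangential_def ambient_metric_diff_left ambient_metric_scaleR_left)

lemma diff_tangential_orthogonal:
  assumes "w \<in> tangent_space c p"
  shows "ambient_metric c (v - tangential c p v) w = 0"
  using assms
  by (simp add: tangent_space_def tangential_def ambient_metric_scaleR_left ambient_metric_commute[of c p w])

(* Covariant derivative of the vector field V along the curve \<alpha>. The Levi-Civita
   connection of the induced metric is the tangential part of the flat connection of
   the ambient space. Derivatives are taken within I, hence are one-sided at end
   points belonging to I. *)
definition cov_deriv ::
  "real \<Rightarrow> real set \<Rightarrow> (real \<Rightarrow> 'm::finite ambient) \<Rightarrow> (real \<Rightarrow> 'm ambient) \<Rightarrow> real \<Rightarrow> 'm ambient"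
  where
  "cov_deriv c I \<alpha> V t = tangential c (\<alpha> t) (vector_derivative V (at t within I))"

definition C2_curve_on :: "real set \<Rightarrow> (real \<Rightarrow> 'm::finite ambient) \<Rightarrow> bool" where
  "C2_curve_on I \<alpha> \<longleftrightarrow>
     (\<exists>\<alpha>' \<alpha>''. (\<forall>t\<in>I. (\<alpha> has_vector_derivative \<alpha>' t) (at t within I)) \<and>
              (\<forall>t\<in>I. (\<alpha>' has_vector_derivative \<alpha>'' t) (at t within I)) \<and>
              continuous_on I \<alpha>'')"

definition arc_length_param :: "real \<Rightarrow> real set \<Rightarrow> (real \<Rightarrow> 'm::finite ambient) \<Rightarrow> bool" where
  "arc_length_param c I \<alpha> \<longleftrightarrow>
     (\<forall>t\<in>I. ambient_metric c (vector_derivative \<alpha> (at t within I))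
                     (vector_derivative \<alpha> (at t within I)) = 1)"

(* The N i are only required to be differentiable; the last condition then makes them C^1
   along a C^2 curve. Since tangent_space c (\<alpha> t) has dimension n + 1, an orthonormal
   family of n + 1 tangent vectors is a basis of it. *)
definition rm_frame ::
  "real \<Rightarrow> nat \<Rightarrow> real set \<Rightarrow> (real \<Rightarrow> 'm::finite ambient) \<Rightarrow>
     (real \<Rightarrow> 'm ambient) \<Rightarrow> (nat \<Rightarrow> real \<Rightarrow> 'm ambient) \<Rightarrow> bool"
  where
  "rm_frame c n I \<alpha> T N \<longleftrightarrow>
     (\<forall>t\<in>I. T t = vector_derivative \<alpha> (at t within I)) \<and>
     (\<forall>i\<in>{1..n}. \<forall>t\<in>I. N i differentiable (at t within I)) \<and>
     (\<forall>t\<in>I. T t \<in> tangent_space c (\<alpha> t) \<and> (\<forall>i\<in>{1..n}. N i t \<in> tangent_space c (\<alpha> t))) \<and>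
     (\<forall>t\<in>I. ambient_metric c (T t) (T t) = 1 \<and>
            (\<forall>i\<in>{1..n}. ambient_metric c (T t) (N i t) = 0) \<and>
            (\<forall>i\<in>{1..n}. \<forall>j\<in>{1..n}. ambient_metric c (N i t) (N j t) = (if i = j then 1 else 0))) \<and>
     (\<forall>i\<in>{1..n}. \<forall>t\<in>I. \<exists>r. cov_deriv c I \<alpha> (N i) t = r *\<^sub>R T t)"

definition rm_curvatures ::
  "real \<Rightarrow> nat \<Rightarrow> real set \<Rightarrow> (real \<Rightarrow> 'm::finite ambient) \<Rightarrow>
     (real \<Rightarrow> 'm ambient) \<Rightarrow> (nat \<Rightarrow> real \<Rightarrow> 'm ambient) \<Rightarrow> (nat \<Rightarrow> real \<Rightarrow> real) \<Rightarrow> bool"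
  where
  "rm_curvatures c n I \<alpha> T N \<kappa> \<longleftrightarrow>
     (\<forall>t\<in>I. cov_deriv c I \<alpha> T t = (\<Sum>i=1..n. \<kappa> i t *\<^sub>R N i t)) \<and>
     (\<forall>i\<in>{1..n}. \<forall>t\<in>I. cov_deriv c I \<alpha> (N i) t = - \<kappa> i t *\<^sub>R T t)"

definition umb_set :: "real \<Rightarrow> 'm::finite ambient \<Rightarrow> real \<Rightarrow> 'm ambient set" where
  "umb_set c a \<sigma> = {p \<in> space_form c. ambient_metric c p a = \<sigma>}"

(* Nonemptiness is not implied by the other conditions: for c = -1 and a causal vector a,
   the sign of \<sigma> has to match the time orientation of a. *)
definition umb_data :: "real \<Rightarrow> 'm::finite ambient \<Rightarrow> real \<Rightarrow> bool" where
  "umb_data c a \<sigma> \<longleftrightarrow>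
     a \<noteq> 0 \<and>
     (c = 1 \<and> ambient_metric c a a = 1 \<and> -1 < \<sigma> \<and> \<sigma> < 1 \<or>
      c = -1 \<and> (ambient_metric c a a = 1 \<or>
                 ambient_metric c a a = 0 \<and> \<sigma> \<noteq> 0 \<or>
                 ambient_metric c a a = -1 \<and> \<bar>\<sigma>\<bar> > 1)) \<and>
     umb_set c a \<sigma> \<noteq> {}"

definition totally_umbilical_hypersurface :: "real \<Rightarrow> 'm::finite ambient set \<Rightarrow> bool" where
  "totally_umbilical_hypersurface c S \<longleftrightarrow> (\<exists>a \<sigma>. umb_data c a \<sigma> \<and> S = umb_set c a \<sigma>)"

(* A relation with all coefficients a 1, ..., a n and \<sigma> equal to 0 holds along every curve
   and carries no information, so it does not count as a linear relation. *)
definition linear_relation ::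
  "nat \<Rightarrow> real set \<Rightarrow> (nat \<Rightarrow> real \<Rightarrow> real) \<Rightarrow> (nat \<Rightarrow> real) \<Rightarrow> real \<Rightarrow> bool"
  where
  "linear_relation n I \<kappa> a \<sigma> \<longleftrightarrow>
     ((\<exists>i\<in>{1..n}. a i \<noteq> 0) \<or> \<sigma> \<noteq> 0) \<and>
     (\<forall>s\<in>I. (\<Sum>i=1..n. a i * \<kappa> i s) + \<sigma> = 0)"

end

theory Submission
  imports Defs
begin

text \<open>
  Write \<open>\<langle>\<cdot>,\<cdot>\<rangle>\<close> for the ambient metric. Since \<open>\<langle>\<alpha>,\<alpha>\<rangle> = c\<close> and \<open>\<langle>T,\<alpha>\<rangle> = \<langle>N\<^sub>i,\<alpha>\<rangle> = 0\<close>, the frame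
  equations of the space form become, in the flat ambient space and with \<open>c\<^sup>2 = 1\<close>,
  \<open>\<alpha>' = T\<close>, \<open>T' = \<Sum>\<^sub>i \<kappa>\<^sub>i N\<^sub>i - c \<alpha>\<close> and \<open>N\<^sub>i' = - \<kappa>\<^sub>i T\<close>.
  Both directions follow by differentiating the right quantity.

  If \<open>\<langle>\<alpha>,v\<rangle> = \<sigma>\<close>, then \<open>\<langle>T,v\<rangle> = 0\<close>, so every \<open>\<langle>N\<^sub>i,v\<rangle>\<close> has derivative \<open>- \<kappa>\<^sub>i \<langle>T,v\<rangle> = 0\<close> and is constant.
  One more derivative of \<open>\<langle>T,v\<rangle> = 0\<close> gives \<open>\<Sum>\<^sub>i \<langle>N\<^sub>i,v\<rangle> \<kappa>\<^sub>i - c \<sigma> = 0\<close>, and multiplication by \<open>- c\<close> gives the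
  relation. It is not the trivial one: \<open>\<alpha>, T, N\<^sub>1, \<dots>, N\<^sub>n\<close> is an orthogonal basis of the ambient
  space, to which a nonzero \<open>v\<close> cannot be orthogonal
  (\<open>orthogonal_to_moving_basis_imp_zero\<close>).

  Conversely, \<open>v = \<Sum>\<^sub>i a\<^sub>i N\<^sub>i - \<sigma> \<alpha>\<close> has derivative \<open>- (\<Sum>\<^sub>i a\<^sub>i \<kappa>\<^sub>i + \<sigma>) T\<close>, so under the relation it is
  constant, and \<open>\<langle>\<alpha>,v\<rangle> = - c \<sigma>\<close>. It remains to rescale \<open>v\<close> to an admissible normal vector. This is
  possible precisely because \<open>\<langle>v,v\<rangle> - c \<langle>\<alpha>,v\<rangle>\<^sup>2 = \<Sum>\<^sub>i a\<^sub>i\<^sup>2\<close> is positive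
  (\<open>hyperplane_section_subset_umbilical\<close>): the square length of the part of \<open>v\<close>
  tangent to the space form decides, in all causal cases at once, whether a hyperplane section is an
  umbilical hypersurface.
\<close>

section \<open>The ambient metric\<close>

text \<open>The identity with the Euclidean inner product of the product space yields
  all linearity and differentiation rules and, for \<open>c \<noteq> 0\<close>, nondegeneracy.\<close>

lemma ambient_metric_eq_inner:
  "ambient_metric c p q = p \<bullet> (fst q, c * snd q)"
  by (simp add: ambient_metric_def inner_prod_def inner_vec_def mult_ac)

lemma bounded_bilinear_ambient_metric:
  "bounded_bilinear (ambient_metric c :: 'm::finite ambient \<Rightarrow> _)"
proof -
  have "linear (\<lambda>q::'m ambient. (fst q, c * snd q))"
    by (rule linearI) (auto simp: algebra_simps)
  then have "bounded_linear (\<lambda>q::'m ambient. (fst q, c * snd q))"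
    by (rule linear_conv_bounded_linear[THEN iffD1])
  then show ?thesis
    unfolding ambient_metric_eq_inner[abs_def]
    by (rule bounded_bilinear.comp[OF bounded_bilinear_inner bounded_linear_ident])
qed

lemmas ambient_metric_add_left = bounded_bilinear.add_left[OF bounded_bilinear_ambient_metric]
  and ambient_metric_diff_right = bounded_bilinear.diff_right[OF bounded_bilinear_ambient_metric]
  and ambient_metric_scaleR_right =
    bounded_bilinear.scaleR_right[OF bounded_bilinear_ambient_metric, simplified]
  and ambient_metric_sum_left = bounded_bilinear.sum_left[OF bounded_bilinear_ambient_metric]
  and ambient_metric_sum_right = bounded_bilinear.sum_right[OF bounded_bilinear_ambient_metric]
  and ambient_metric_zero_left = bounded_bilinear.zero_left[OF bounded_bilinear_ambient_metric]
  and ambient_metric_zero_right = bounded_bilinear.zero_right[OF bounded_bilinear_ambient_metric]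
  and has_vector_derivative_ambient_metric =
    bounded_bilinear.has_vector_derivative[OF bounded_bilinear_ambient_metric]

lemma ambient_metric_nondegenerate:
  fixes v :: "'m::finite ambient"
  assumes "c \<noteq> 0" and "\<And>u. ambient_metric c u v = 0"
  shows "v = 0"
proof -
  have "(fst v, c * snd v) \<bullet> (fst v, c * snd v) = 0"
    using assms(2) unfolding ambient_metric_eq_inner .
  then show ?thesis
    using assms(1) by (simp only: inner_eq_zero_iff) (simp add: prod_eq_iff)
qed

text \<open>For an indefinite metric, orthogonality yields independence only if the vectors are not
  null: this is where \<open>\<langle>e,e\<rangle> \<noteq> 0\<close> is used.\<close>

lemma independent_if_orthogonal_nonnull:
  fixes E :: "'m::finite ambient set"
  assumes fin: "finite E"
    and orth: "\<And>d e. d \<in> E \<Longrightarrow> e \<in> E \<Longrightarrow> d \<noteq> e \<Longrightarrow> ambient_metric c d e = 0"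
    and nonnull: "\<And>e. e \<in> E \<Longrightarrow> ambient_metric c e e \<noteq> 0"
  shows "independent E"
proof (rule independent_if_scalars_zero[OF fin])
  fix f e
  assume sum0: "(\<Sum>d\<in>E. f d *\<^sub>R d) = 0" and e: "e \<in> E"
  have "0 = ambient_metric c (\<Sum>d\<in>E. f d *\<^sub>R d) e"
    by (simp add: sum0 ambient_metric_zero_left)
  also have "\<dots> = (\<Sum>d\<in>E. f d * ambient_metric c d e)"
    by (simp add: ambient_metric_sum_left ambient_metric_scaleR_left)
  also have "\<dots> = (\<Sum>d\<in>E. if d = e then f e * ambient_metric c e e else 0)"
    using orth e by (intro sum.cong) auto
  also have "\<dots> = f e * ambient_metric c e e"
    using fin e by simp
  finally show "f e = 0"
    using nonnull[OF e] by simp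
qed

lemma orthogonal_to_orthogonal_basis_imp_zero:
  fixes E :: "'m::finite ambient set"
  assumes "c \<noteq> 0" and fin: "finite E"
    and orth: "\<And>d e. d \<in> E \<Longrightarrow> e \<in> E \<Longrightarrow> d \<noteq> e \<Longrightarrow> ambient_metric c d e = 0"
    and nonnull: "\<And>e. e \<in> E \<Longrightarrow> ambient_metric c e e \<noteq> 0"
    and card: "card E = CARD('m) + 1"
    and v: "\<And>e. e \<in> E \<Longrightarrow> ambient_metric c e v = 0"
  shows "v = 0"
proof -
  have "independent E"
    using fin orth nonnull by (rule independent_if_orthogonal_nonnull)
  then have span: "UNIV \<subseteq> span E"
    by (rule card_ge_dim_independent[OF subset_UNIV]) (simp add: card)
  have "ambient_metric c u v = 0" for u
  proof -
    have "u \<in> span E"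
      using span by blast
    then show ?thesis
      by (induction rule: span_induct_alt)
        (simp_all add: ambient_metric_zero_left ambient_metric_add_left
          ambient_metric_scaleR_left v)
  qed
  with \<open>c \<noteq> 0\<close> show ?thesis
    by (rule ambient_metric_nondegenerate)
qed

section \<open>Hyperplane sections that are umbilical hypersurfaces\<close>

text \<open>At a point \<open>p\<close> of the section, the part of \<open>v\<close> tangent to the space form has square length
  \<open>\<langle>v,v\<rangle> - c \<tau>\<^sup>2\<close>, so the hypothesis says that the hyperplane meets the space form transversally along a
  spacelike normal. Rescaling \<open>v\<close> to square length \<open>1\<close>, \<open>0\<close> or \<open>-1\<close> preserves this inequality, which
  then turns into the bound on \<open>\<sigma>\<close> that each causal type demands.\<close>

lemma hyperplane_section_subset_umbilical:
  fixes v :: "'m::finite ambient"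
  assumes c: "c \<in> {-1, 1}"
    and X: "X \<noteq> {}" "X \<subseteq> space_form c" and level: "\<And>p. p \<in> X \<Longrightarrow> ambient_metric c p v = \<tau>"
    and spacelike: "c * \<tau>\<^sup>2 < ambient_metric c v v"
  shows "\<exists>S. totally_umbilical_hypersurface c S \<and> X \<subseteq> S"
proof -
  define q where "q = ambient_metric c v v"
  \<comment> \<open>A null vector has no preferred length and is kept as it is.\<close>
  define r where "r = (if q = 0 then 1 else 1 / sqrt \<bar>q\<bar>)"
  have r: "r \<noteq> 0"
    by (simp add: r_def)
  have r2: "q \<noteq> 0 \<Longrightarrow> r\<^sup>2 = 1 / \<bar>q\<bar>"
    by (simp add: r_def power_divide)
  have q: "c * \<tau>\<^sup>2 < q"
    using spacelike by (simp add: q_def)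
  have metric: "ambient_metric c (r *\<^sub>R v) (r *\<^sub>R v) = r\<^sup>2 * q"
    by (simp add: ambient_metric_scaleR_left ambient_metric_scaleR_right q_def power2_eq_square)
  have sub: "X \<subseteq> umb_set c (r *\<^sub>R v) (r * \<tau>)"
    using X level by (auto simp: umb_set_def ambient_metric_scaleR_right)
  have v: "v \<noteq> 0"
  proof
    assume "v = 0"
    moreover from this X level have "\<tau> = 0"
      by (auto simp: ambient_metric_zero_right)
    ultimately show False
      using spacelike by (simp add: ambient_metric_zero_right)
  qed
  have type: "c = 1 \<and> r\<^sup>2 * q = 1 \<and> -1 < r * \<tau> \<and> r * \<tau> < 1 \<or>
      c = -1 \<and> (r\<^sup>2 * q = 1 \<or> r\<^sup>2 * q = 0 \<and> r * \<tau> \<noteq> 0 \<or> r\<^sup>2 * q = -1 \<and> \<bar>r * \<tau>\<bar> > 1)"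
  proof (cases "c = 1")
    case True
    with q have "q > \<tau>\<^sup>2"
      by simp
    then have pos: "q > 0"
      by (rule le_less_trans[OF zero_le_power2])
    then have "(r * \<tau>)\<^sup>2 < 1"
      using \<open>q > \<tau>\<^sup>2\<close> by (simp add: power_mult_distrib r2)
    then have "\<bar>r * \<tau>\<bar> < 1"
      by (simp only: abs_square_less_1)
    then show ?thesis
      using True pos r2 by (auto simp: abs_less_iff)
  next
    case False
    with c have c: "c = -1"
      by simp
    consider "q > 0" | "q = 0" | "q < 0"
      by linarith
    then show ?thesis
    proof cases
      case 1
      then show ?thesis
        using c r2 by simp
    next
      case 2
      then show ?thesis
        using c q r by auto
    next
      case 3
      then have "1 < (r * \<tau>)\<^sup>2"
        using c q by (simp add: power_mult_distrib r2 less_divide_eq divide_less_eq)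
      then have "\<not> \<bar>r * \<tau>\<bar> \<le> 1"
        by (simp only: abs_square_le_1[symmetric] not_le)
      then show ?thesis
        using c 3 r2 by simp
    qed
  qed
  have "umb_data c (r *\<^sub>R v) (r * \<tau>)"
    unfolding umb_data_def metric using v r X(1) sub type by auto
  then show ?thesis
    using sub unfolding totally_umbilical_hypersurface_def by blast
qed

section \<open>Frame equations in the ambient space\<close>

text \<open>A nondegenerate interval has no isolated points, so one-sided derivatives at its end points are
  unique as well.\<close>

lemma at_within_interval_neq_bot:
  fixes t :: real
  assumes "is_interval I" and "interior I \<noteq> {}" and "t \<in> I"
  shows "at t within I \<noteq> bot"
proof -
  have "I \<noteq> {x}" for x
    using assms(2) by auto
  then have "t islimpt I"
    using assms by (intro connected_imp_perfect) (auto simp: is_interval_connected)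
  then show ?thesis
    by (simp add: trivial_limit_within)
qed

lemma constant_on_interval_if_derivative_zero:
  fixes f :: "real \<Rightarrow> 'b::real_normed_vector"
  assumes "is_interval I"
    and "\<And>t. t \<in> I \<Longrightarrow> (f has_vector_derivative 0) (at t within I)"
  obtains k where "\<And>t. t \<in> I \<Longrightarrow> f t = k"
  using has_derivative_zero_constant[of I f] assms
  by (auto simp: has_vector_derivative_def is_interval_convex)

locale rm_framed_curve =
  fixes c :: real and n :: nat and I :: "real set"
    and \<alpha> T :: "real \<Rightarrow> 'm::finite ambient" and N :: "nat \<Rightarrow> real \<Rightarrow> 'm ambient"
    and \<kappa> :: "nat \<Rightarrow> real \<Rightarrow> real"
  assumes c: "c \<in> {-1, 1}"
    and card: "CARD('m) = n + 1"
    and interval: "is_interval I" and interior: "interior I \<noteq> {}"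
    and in_space_form: "\<alpha> ` I \<subseteq> space_form c"
    and C2: "C2_curve_on I \<alpha>"
    and frame: "rm_frame c n I \<alpha> T N"
    and curvatures: "rm_curvatures c n I \<alpha> T N \<kappa>"
begin

lemma c_square: "c * c = 1"
  using c by auto

lemma I_nonempty: "I \<noteq> {}"
  using interior by auto

lemma metric_position:
  assumes "t \<in> I"
  shows "ambient_metric c (\<alpha> t) (\<alpha> t) = c"
  using in_space_form assms by (auto simp: space_form_def)

lemma frame_orthonormal:
  assumes "t \<in> I"
  shows metric_T_T: "ambient_metric c (T t) (T t) = 1"
    and metric_T_N: "i \<in> {1..n} \<Longrightarrow> ambient_metric c (T t) (N i t) = 0"
    and metric_N_N: "i \<in> {1..n} \<Longrightarrow> j \<in> {1..n} \<Longrightarrow>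
      ambient_metric c (N i t) (N j t) = (if i = j then 1 else 0)"
    and metric_T_position: "ambient_metric c (T t) (\<alpha> t) = 0"
    and metric_N_position: "i \<in> {1..n} \<Longrightarrow> ambient_metric c (N i t) (\<alpha> t) = 0"
  using frame assms unfolding rm_frame_def tangent_space_def by auto

lemma derivative_zero_if_constant:
  assumes t: "t \<in> I" and const: "\<And>s. s \<in> I \<Longrightarrow> f s = k"
    and deriv: "(f has_vector_derivative D) (at t within I)"
  shows "D = 0"
proof -
  have "(f has_vector_derivative 0) (at t within I)"
    using t const by (rule has_vector_derivative_transform) simp_all
  with deriv show ?thesis
    by (rule vector_derivative_unique_within[OF at_within_interval_neq_bot[OF interval interior t]])
qed

lemma has_vector_derivative_position:
  assumes t: "t \<in> I"
  shows "(\<alpha> has_vector_derivative T t) (at t within I)"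
proof -
  have "\<alpha> differentiable (at t within I)"
    using C2 t unfolding C2_curve_on_def by (blast intro: differentiableI_vector)
  moreover have "T t = vector_derivative \<alpha> (at t within I)"
    using frame t by (simp add: rm_frame_def)
  ultimately show ?thesis
    by (simp add: vector_derivative_works)
qed

lemma T_differentiable:
  assumes t: "t \<in> I"
  shows "T differentiable (at t within I)"
proof -
  from C2 obtain \<alpha>' \<alpha>'' where
    1: "\<And>t. t \<in> I \<Longrightarrow> (\<alpha> has_vector_derivative \<alpha>' t) (at t within I)" and
    2: "\<And>t. t \<in> I \<Longrightarrow> (\<alpha>' has_vector_derivative \<alpha>'' t) (at t within I)"
    unfolding C2_curve_on_def by blast
  have "T s = \<alpha>' s" if "s \<in> I" for s
    using at_within_interval_neq_bot[OF interval interior that]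
      has_vector_derivative_position[OF that] 1[OF that]
    by (rule vector_derivative_unique_within)
  then have "(T has_vector_derivative \<alpha>'' t) (at t within I)"
    by (rule has_vector_derivative_transform[OF t _ 2[OF t]])
  then show ?thesis
    by (rule differentiableI_vector)
qed

text \<open>The normal component of the flat derivative of a tangent field \<open>V\<close> is forced by
  \<open>\<langle>V,\<alpha>\<rangle> = 0\<close>, whose derivative gives \<open>\<langle>V',\<alpha>\<rangle> = - \<langle>V,T\<rangle>\<close> (the Gauss formula of the space form).\<close>

lemma has_vector_derivative_tangent_field:
  assumes t: "t \<in> I" and diff: "V differentiable (at t within I)"
    and tangent: "\<And>s. s \<in> I \<Longrightarrow> ambient_metric c (V s) (\<alpha> s) = 0"
  shows "(V has_vector_derivative
    cov_deriv c I \<alpha> V t - (c * ambient_metric c (V t) (T t)) *\<^sub>R \<alpha> t) (at t within I)"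
proof -
  define V' where "V' = vector_derivative V (at t within I)"
  have V': "(V has_vector_derivative V') (at t within I)"
    using diff by (simp add: V'_def vector_derivative_works)
  have "ambient_metric c (V t) (T t) + ambient_metric c V' (\<alpha> t) = 0"
    using has_vector_derivative_ambient_metric[OF V' has_vector_derivative_position[OF t]] tangent
    by (intro derivative_zero_if_constant[OF t])
  then have "ambient_metric c V' (\<alpha> t) = - ambient_metric c (V t) (T t)"
    by linarith
  moreover have "x / c = c * x" for x
    using c by auto
  ultimately have "V' = cov_deriv c I \<alpha> V t - (c * ambient_metric c (V t) (T t)) *\<^sub>R \<alpha> t"
    by (simp add: cov_deriv_def tangential_def V'_def[symmetric] metric_position[OF t])
  with V' show ?thesis
    by simp
qed

lemma has_vector_derivative_T:
  assumes t: "t \<in> I"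
  shows "(T has_vector_derivative (\<Sum>i=1..n. \<kappa> i t *\<^sub>R N i t) - c *\<^sub>R \<alpha> t) (at t within I)"
  using has_vector_derivative_tangent_field[OF t T_differentiable[OF t] metric_T_position]
    curvatures t by (simp add: metric_T_T rm_curvatures_def)

lemma has_vector_derivative_N:
  assumes t: "t \<in> I" and i: "i \<in> {1..n}"
  shows "(N i has_vector_derivative - \<kappa> i t *\<^sub>R T t) (at t within I)"
proof -
  have "N i differentiable (at t within I)"
    using frame t i by (simp add: rm_frame_def)
  moreover have "ambient_metric c (N i t) (T t) = 0"
    using metric_T_N[OF t i] by (simp add: ambient_metric_commute)
  moreover have "cov_deriv c I \<alpha> (N i) t = - \<kappa> i t *\<^sub>R T t"
    using curvatures t i by (simp add: rm_curvatures_def)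
  ultimately show ?thesis
    using has_vector_derivative_tangent_field[OF t, of "N i"] metric_N_position[OF _ i] by simp
qed

text \<open>The position vector completes the frame to \<open>n + 2\<close> orthogonal vectors that are not null, hence
  to a basis of the ambient space.\<close>

lemma orthogonal_to_moving_basis_imp_zero:
  assumes t: "t \<in> I" and pos: "ambient_metric c (\<alpha> t) v = 0" and T: "ambient_metric c (T t) v = 0"
    and N: "\<And>i. i \<in> {1..n} \<Longrightarrow> ambient_metric c (N i t) v = 0"
  shows "v = 0"
proof -
  note onb = frame_orthonormal[OF t] metric_position[OF t]
  note sym = ambient_metric_commute[of c "\<alpha> t" "T t"] ambient_metric_commute[of c "\<alpha> t" "N _ t"]
    ambient_metric_commute[of c "N _ t" "T t"]
  let ?NN = "(\<lambda>i. N i t) ` {1..n}"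
  have c0: "c \<noteq> 0"
    using c by auto
  have inj: "inj_on (\<lambda>i. N i t) {1..n}"
  proof (rule inj_onI, rule ccontr)
    fix i j
    assume ij: "i \<in> {1..n}" "j \<in> {1..n}" "N i t = N j t" "i \<noteq> j"
    then show False
      using metric_N_N[OF t ij(1) ij(2)] metric_N_N[OF t ij(1) ij(1)] by simp
  qed
  have T_notin: "T t \<notin> ?NN"
    using metric_T_T[OF t] metric_T_N[OF t] by force
  have pos_notin: "\<alpha> t \<notin> insert (T t) ?NN"
    using c0 metric_position[OF t] metric_T_position[OF t] metric_N_position[OF t] by force
  show ?thesis
  proof (rule orthogonal_to_orthogonal_basis_imp_zero[OF c0])
    let ?E = "insert (\<alpha> t) (insert (T t) ?NN)"
    show "finite ?E"
      by simp
    show "card ?E = CARD('m) + 1"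
      using T_notin pos_notin card_image[OF inj] by (simp add: card)
    show "ambient_metric c d e = 0" if "d \<in> ?E" "e \<in> ?E" "d \<noteq> e" for d e
      using that by (auto simp: onb sym split: if_splits)
    show "ambient_metric c e e \<noteq> 0" if "e \<in> ?E" for e
      using that c0 by (auto simp: onb)
    show "ambient_metric c e v = 0" if "e \<in> ?E" for e
      using that pos T N by auto
  qed
qed

section \<open>Umbilical hypersurfaces and linear relations of the curvatures\<close>

lemma linear_relation_if_in_hyperplane:
  assumes v: "v \<noteq> 0" and level: "\<And>t. t \<in> I \<Longrightarrow> ambient_metric c (\<alpha> t) v = \<sigma>"
  shows "\<exists>a. linear_relation n I \<kappa> a \<sigma>"
proof -
  have deriv: "((\<lambda>t. ambient_metric c (V t) v) has_vector_derivative ambient_metric c D v)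
      (at t within I)" if "(V has_vector_derivative D) (at t within I)" for V D t
    using bounded_linear.has_vector_derivative[OF
        bounded_bilinear.bounded_linear_left[OF bounded_bilinear_ambient_metric] that] .
  have T0: "ambient_metric c (T t) v = 0" if t: "t \<in> I" for t
    using t level deriv[OF has_vector_derivative_position[OF t]]
    by (rule derivative_zero_if_constant)
  have "\<exists>k. \<forall>t\<in>I. ambient_metric c (N i t) v = k" if i: "i \<in> {1..n}" for i
  proof -
    have "((\<lambda>t. ambient_metric c (N i t) v) has_vector_derivative 0) (at t within I)"
      if t: "t \<in> I" for t
      using deriv[OF has_vector_derivative_N[OF t i]]
      by (simp only: ambient_metric_scaleR_left T0[OF t] mult_zero_right)
    then show ?thesis
      by (rule constant_on_interval_if_derivative_zero[OF interval]) blast+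
  qed
  then obtain b where b: "\<And>i t. i \<in> {1..n} \<Longrightarrow> t \<in> I \<Longrightarrow> ambient_metric c (N i t) v = b i"
    by metis
  have rel: "(\<Sum>i=1..n. b i * \<kappa> i t) = c * \<sigma>" if t: "t \<in> I" for t
  proof -
    have "ambient_metric c ((\<Sum>i=1..n. \<kappa> i t *\<^sub>R N i t) - c *\<^sub>R \<alpha> t) v = 0"
      using t T0 deriv[OF has_vector_derivative_T[OF t]] by (rule derivative_zero_if_constant)
    then show ?thesis
      using b t level
      by (simp add: ambient_metric_diff_left ambient_metric_sum_left ambient_metric_scaleR_left
          mult.commute)
  qed
  define a where "a i = - c * b i" for i
  have "(\<Sum>i=1..n. a i * \<kappa> i t) + \<sigma> = 0" if t: "t \<in> I" for t
  proof -
    have "(\<Sum>i=1..n. a i * \<kappa> i t) = - c * (\<Sum>i=1..n. b i * \<kappa> i t)"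
      by (simp add: a_def sum_distrib_left sum_negf mult.assoc)
    also have "\<dots> = - (c * c) * \<sigma>"
      by (simp only: rel[OF t]) simp
    finally show ?thesis
      by (simp add: c_square)
  qed
  moreover have "(\<exists>i\<in>{1..n}. a i \<noteq> 0) \<or> \<sigma> \<noteq> 0"
  proof (rule ccontr)
    assume "\<not> ?thesis"
    then have zero: "\<sigma> = 0" "\<And>i. i \<in> {1..n} \<Longrightarrow> b i = 0"
      using c by (auto simp: a_def)
    obtain t where t: "t \<in> I"
      using I_nonempty by blast
    have "v = 0"
      using t level[OF t] T0[OF t] b[OF _ t] zero
      by (intro orthogonal_to_moving_basis_imp_zero[OF t]) auto
    with v show False ..
  qed
  ultimately show ?thesis
    unfolding linear_relation_def by blast
qed

lemma in_umbilical_if_linear_relation: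
  assumes rel: "linear_relation n I \<kappa> a \<sigma>"
  shows "\<exists>S. totally_umbilical_hypersurface c S \<and> \<alpha> ` I \<subseteq> S"
proof -
  have rel0: "(\<Sum>i=1..n. a i * \<kappa> i t) + \<sigma> = 0" if "t \<in> I" for t
    using rel that by (simp add: linear_relation_def)
  define w where "w t = (\<Sum>i=1..n. a i *\<^sub>R N i t) - \<sigma> *\<^sub>R \<alpha> t" for t
  have "(w has_vector_derivative 0) (at t within I)" if t: "t \<in> I" for t
  proof -
    have "(w has_vector_derivative (\<Sum>i=1..n. a i *\<^sub>R (- \<kappa> i t *\<^sub>R T t)) - \<sigma> *\<^sub>R T t) (at t within I)"
      unfolding w_def
      by (intro has_vector_derivative_diff has_vector_derivative_sum
          bounded_linear.has_vector_derivative[OF bounded_linear_scaleR_right]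
          has_vector_derivative_N has_vector_derivative_position t)
    moreover have "(\<Sum>i=1..n. a i *\<^sub>R (- \<kappa> i t *\<^sub>R T t)) - \<sigma> *\<^sub>R T t =
        - ((\<Sum>i=1..n. a i * \<kappa> i t) + \<sigma>) *\<^sub>R T t"
      by (simp add: scaleR_left.sum sum_negf scaleR_left_diff_distrib)
    ultimately show ?thesis
      by (simp only: rel0[OF t] minus_zero scaleR_zero_left)
  qed
  then obtain v where v: "\<And>t. t \<in> I \<Longrightarrow> w t = v"
    by (rule constant_on_interval_if_derivative_zero[OF interval]) blast+
  obtain t\<^sub>0 where t\<^sub>0: "t\<^sub>0 \<in> I"
    using I_nonempty by blast
  have level: "ambient_metric c (\<alpha> t) v = - c * \<sigma>" if t: "t \<in> I" for t
    unfolding v[OF t, symmetric] w_def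
    by (simp add: ambient_metric_diff_right ambient_metric_sum_right ambient_metric_scaleR_right
        ambient_metric_commute[of c "\<alpha> t" "N _ t"] metric_N_position[OF t] metric_position[OF t])
  have N_v: "ambient_metric c (N i t\<^sub>0) v = a i" if i: "i \<in> {1..n}" for i
  proof -
    have "ambient_metric c (N i t\<^sub>0) v = (\<Sum>j=1..n. a j * ambient_metric c (N i t\<^sub>0) (N j t\<^sub>0))"
      unfolding v[OF t\<^sub>0, symmetric] w_def
      by (simp add: ambient_metric_diff_right ambient_metric_sum_right ambient_metric_scaleR_right
          metric_N_position[OF t\<^sub>0 i])
    also have "\<dots> = (\<Sum>j=1..n. if i = j then a j else 0)"
      using metric_N_N[OF t\<^sub>0 i] by (intro sum.cong) auto
    also have "\<dots> = a i"
      using i by simp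
    finally show ?thesis .
  qed
  have v_v: "ambient_metric c v v = (\<Sum>i=1..n. (a i)\<^sup>2) + c * \<sigma>\<^sup>2"
  proof -
    have "ambient_metric c v v = ambient_metric c (w t\<^sub>0) v"
      by (simp add: v[OF t\<^sub>0])
    also have "\<dots> = (\<Sum>i=1..n. (a i)\<^sup>2) + c * \<sigma>\<^sup>2"
      using level[OF t\<^sub>0] N_v
      by (simp add: w_def ambient_metric_diff_left ambient_metric_sum_left
          ambient_metric_scaleR_left power2_eq_square)
    finally show ?thesis .
  qed
  \<comment> \<open>With all \<open>a i\<close> zero the relation would read \<open>\<sigma> = 0\<close> and be trivial.\<close>
  have "\<exists>i\<in>{1..n}. a i \<noteq> 0"
  proof (rule ccontr)
    assume "\<not> ?thesis"
    then have "\<sigma> = 0"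
      using rel0[OF t\<^sub>0] by simp
    with \<open>\<not> ?thesis\<close> rel show False
      by (simp add: linear_relation_def)
  qed
  then have "0 < (\<Sum>i=1..n. (a i)\<^sup>2)"
    by (auto intro: sum_pos2)
  moreover have "(- c * \<sigma>)\<^sup>2 = \<sigma>\<^sup>2"
    using c by auto
  ultimately have spacelike: "c * (- c * \<sigma>)\<^sup>2 < ambient_metric c v v"
    by (simp add: v_v)
  show ?thesis
    using I_nonempty level
    by (intro hyperplane_section_subset_umbilical[OF c _ in_space_form _ spacelike]) auto
qed

end

theorem theorem1p5:
  fixes c :: real and n :: nat and I :: "real set"
    and \<alpha> T :: "real \<Rightarrow> (real ^ 'm::finite) \<times> real"
    and N :: "nat \<Rightarrow> real \<Rightarrow> (real ^ 'm) \<times> real"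
    and \<kappa> :: "nat \<Rightarrow> real \<Rightarrow> real"
  assumes "c \<in> {-1, 1}"
    and "n \<ge> 1"
    and "CARD('m) = n + 1"
    and "is_interval I" and "interior I \<noteq> {}"
    and "\<alpha> ` I \<subseteq> space_form c"
    and "C2_curve_on I \<alpha>"
    and "arc_length_param c I \<alpha>"
    and "rm_frame c n I \<alpha> T N"
    and "rm_curvatures c n I \<alpha> T N \<kappa>"
  shows "(\<forall>v \<sigma>. umb_data c v \<sigma> \<and> \<alpha> ` I \<subseteq> umb_set c v \<sigma> \<longrightarrow>
            (\<exists>a. linear_relation n I \<kappa> a \<sigma>)) \<and>
         (\<forall>a \<sigma>. linear_relation n I \<kappa> a \<sigma> \<longrightarrow>
            (\<exists>S. totally_umbilical_hypersurface c S \<and> \<alpha> ` I \<subseteq> S))"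
proof -
  interpret rm_framed_curve c n I \<alpha> T N \<kappa>
    using assms by unfold_locales
  show ?thesis
  proof (intro conjI allI impI)
    fix v \<sigma>
    assume "umb_data c v \<sigma> \<and> \<alpha> ` I \<subseteq> umb_set c v \<sigma>"
    then show "\<exists>a. linear_relation n I \<kappa> a \<sigma>"
      by (intro linear_relation_if_in_hyperplane) (auto simp: umb_data_def umb_set_def)
  next
    fix a \<sigma>
    assume "linear_relation n I \<kappa> a \<sigma>"
    then show "\<exists>S. totally_umbilical_hypersurface c S \<and> \<alpha> ` I \<subseteq> S"
      by (rule in_umbilical_if_linear_relation)
  qed
qed

end
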